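(* Let $\mu$ be a non-trivial probability measure supported on $[-1,1]$ with recurrence coefficients $\{b_n\}_{n\ge1}$, $\{d_n\}_{n\ge1}$. Fix an integer $k\ge 1$, and let $\{P^{(-k)}_n\}_{n\ge0}$ be the anti-associated polynomials of order $k$ obtained from new coefficients $b_{1-k},\dots,b_0$ and $d_{1-k},\dots,d_0$, whose orthogonality measure is assumed to be supported on $[-1,1]$. Let $\{\tilde\alpha_n\}_{n\ge0}$ be the Verblunsky coefficients of the orthogonal polynomials on the unit circle corresponding to $\{P^{(-k)}_n\}_{n\ge0}$ through the Szegő transformation. Then, with the convention $\tilde\alpha_{-1}=-1$, $$\tilde\alpha_0=b_{1-k},\qquad \tilde\alpha_1=-1+\frac{2d_{1-k}}{1-\tilde\alpha_0^2},$$ $$\tilde\alpha_{2m}=\frac{2b_{m-k+1}+(1+\tilde\alpha_{2m-1})\tilde\alpha_{2m-2}}{1-\tilde\alpha_{2m-1}},\qquad m\ge1,$$ $$\tilde\alpha_{2m+1}=-1+\frac{4d_{m-k+1}}{(1-\tilde\alpha_{2m-1})(1-\tilde\alpha_{2m}^2)},\qquad m\ge1.$$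
   Context: The monic orthogonal polynomials $P_n$ of $\mu$ satisfy $P_{n+1}(x)=(x-b_{n+1})P_n(x)-d_nP_{n-1}(x)$, $n\ge0$, $P_{-1}=0$, $P_0=1$, with $b_n\in\mathbb R$, $d_n>0$ for $n\ge1$. Anti-associated polynomials of order $k$: given new numbers $b_{-i}\in\mathbb R$ and $d_{-i}>0$ ($i=k-1,k-2,\dots,0$), these are placed in front of the diagonal and lower subdiagonal, respectively, of the monic Jacobi matrix. That is, $\{P_n^{(-k)}\}$ is the monic sequence satisfying $P^{(-k)}_{n+1}(x)=(x-\tilde b_{n+1})P^{(-k)}_n(x)-\tilde d_nP^{(-k)}_{n-1}(x)$, $P_{-1}^{(-k)}=0$, $P_0^{(-k)}=1$, with $\tilde b_n=b_{n-k}$, $\tilde d_n=d_{n-k}$ for $n\ge1$ (here $d_0$ is one of the new coefficients). Let $\mu^{(-k)}$ be its orthogonality probability measure. Szegő transformation: a probability measure $\nu$ on $[-1,1]$ is sent to the probability measure $\mathrm{Sz}(\nu)$ on the unit circle given by $d\,\mathrm{Sz}(\nu)(\theta)=\frac12|d\nu(\cos\theta)|$, i.e. the measure invariant under $\theta\mapsto-\theta$ whose push-forward under $e^{i\theta}\mapsto\cos\theta$ is $\nu$. For a non-trivial probability measure on the unit circle with monic orthogonal polynomials $\Phi_n$, the Verblunsky coefficients are $\alpha_n=-\overline{\Phi_{n+1}(0)}$, $n\ge0$. The $\tilde\alpha_n$ in the claim are those of $\mathrm{Sz}(\mu^{(-k)})$. *)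

theory Defs
  imports
    "HOL-Probability.Probability"
    "HOL-Computational_Algebra.Polynomial"
begin

definition msupport :: "'a::topological_space measure \<Rightarrow> 'a set" where
  "msupport M = {x. \<forall>U. open U \<longrightarrow> x \<in> U \<longrightarrow> emeasure M U > 0}"

definition nontrivial_measure :: "'a::topological_space measure \<Rightarrow> bool" where
  "nontrivial_measure M \<longleftrightarrow> infinite (msupport M)"

definition monic_orthogonal_line :: "real measure \<Rightarrow> (nat \<Rightarrow> real poly) \<Rightarrow> bool" where
  "monic_orthogonal_line M P \<longleftrightarrow>
     (\<forall>n. integrable M (\<lambda>x. x ^ n)) \<and>
     (\<forall>n. degree (P n) = n \<and> lead_coeff (P n) = 1) \<and>
     (\<forall>m n. m \<noteq> n \<longrightarrow> (\<integral>x. poly (P m) x * poly (P n) x \<partial>M) = 0)"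

text \<open>
  Coefficient sequences are indexed by integers, so that new coefficients can be put in front of
  the given ones. The recurrence only reads \<open>b n\<close> and \<open>d n\<close> for \<open>n \<ge> 1\<close>.
\<close>

fun recurrence_poly :: "(int \<Rightarrow> real) \<Rightarrow> (int \<Rightarrow> real) \<Rightarrow> nat \<Rightarrow> real poly" where
  "recurrence_poly b d 0 = 1"
| "recurrence_poly b d (Suc 0) = [:- b 1, 1:]"
| "recurrence_poly b d (Suc (Suc n)) =
     [:- b (int n + 2), 1:] * recurrence_poly b d (Suc n)
     - smult (d (int n + 1)) (recurrence_poly b d n)"

definition recurrence_coeffs :: "real measure \<Rightarrow> (int \<Rightarrow> real) \<Rightarrow> (int \<Rightarrow> real) \<Rightarrow> bool" where
  "recurrence_coeffs M b d \<longleftrightarrow>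
     (\<forall>n\<ge>1. d n > 0) \<and> monic_orthogonal_line M (recurrence_poly b d)"

definition anti_associated :: "nat \<Rightarrow> (int \<Rightarrow> real) \<Rightarrow> (int \<Rightarrow> real) \<Rightarrow> nat \<Rightarrow> real poly" where
  "anti_associated k b d = recurrence_poly (\<lambda>n. b (n - int k)) (\<lambda>n. d (n - int k))"

definition monic_orthogonal_circle :: "complex measure \<Rightarrow> (nat \<Rightarrow> complex poly) \<Rightarrow> bool" where
  "monic_orthogonal_circle M \<Phi> \<longleftrightarrow>
     (\<forall>n. degree (\<Phi> n) = n \<and> lead_coeff (\<Phi> n) = 1) \<and>
     (\<forall>m n. m \<noteq> n \<longrightarrow> (\<integral>z. poly (\<Phi> m) z * cnj (poly (\<Phi> n) z) \<partial>M) = 0)"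

text \<open>Only meaningful for a non-trivial probability measure on the unit circle, for which the
  sequence exists and is unique.\<close>

definition monic_opuc :: "complex measure \<Rightarrow> nat \<Rightarrow> complex poly" where
  "monic_opuc M = (THE \<Phi>. monic_orthogonal_circle M \<Phi>)"

text \<open>The index is an integer to accommodate the convention that the coefficient at \<open>-1\<close>
  is \<open>-1\<close>.\<close>

definition verblunsky :: "complex measure \<Rightarrow> int \<Rightarrow> complex" where
  "verblunsky M n = (if n < 0 then - 1 else - cnj (poly (monic_opuc M (nat (n + 1))) 0))"

text \<open>
  The law of \<open>e\<^sup>i\<^sup>\<theta>\<close> for \<open>\<theta> = \<plusminus> arccos x\<close>, where \<open>x\<close> is distributed according to \<open>M\<close> and the
  sign is an independent fair coin toss. For a probability measure on \<open>[-1, 1]\<close> this is the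
  probability measure on the unit circle that is invariant under conjugation and is pushed
  forward to \<open>M\<close> by \<open>e\<^sup>i\<^sup>\<theta> \<mapsto> cos \<theta>\<close>; see the lemmas below.
\<close>

definition szego_measure :: "real measure \<Rightarrow> complex measure" where
  "szego_measure M =
     distr (measure_pmf (pmf_of_set {1, - 1}) \<Otimes>\<^sub>M M) borel (\<lambda>(s, x). cis (s * arccos x))"

lemma borel_measurable_arccos [measurable]: "arccos \<in> borel_measurable borel"
proof -
  have "arccos x = (if x \<in> {-1..1} then arccos x else (THE _. False))" for x :: real
  proof (cases "x \<in> {-1..1}")
    case False
    then have "(\<lambda>t. 0 \<le> t \<and> t \<le> pi \<and> cos t = x) = (\<lambda>_. False)"
      by auto
    with False show ?thesis
      unfolding arccos_def by presburger
  qed simp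
  moreover have "(\<lambda>x::real. if x \<in> {-1..1} then arccos x else (THE _. False)) \<in> borel_measurable borel"
    by (intro borel_measurable_continuous_on_if) (auto intro!: continuous_intros)
  ultimately show ?thesis
    by presburger
qed

lemma measurable_szego:
  assumes "sets M = sets borel"
  shows "(\<lambda>(s, x). cis (s * arccos x)) \<in> measurable (measure_pmf p \<Otimes>\<^sub>M M) borel"
proof -
  have [measurable]: "fst \<in> borel_measurable (measure_pmf p \<Otimes>\<^sub>M M)"
    by (rule measurable_compose[OF measurable_fst]) simp
  have [measurable]: "(\<lambda>q. arccos (snd q)) \<in> borel_measurable (measure_pmf p \<Otimes>\<^sub>M M)"
    by (rule measurable_compose[OF measurable_snd])
      (use borel_measurable_arccos measurable_cong_sets[OF assms refl] in blast)
  have [measurable]: "cis \<in> borel_measurable borel"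
    by (intro borel_measurable_continuous_onI) (auto intro!: continuous_intros)
  show ?thesis
    unfolding split_beta by measurable
qed

lemma emeasure_szego_measure:
  assumes "prob_space M" and "sets M = sets borel" and A: "A \<in> sets borel"
  shows "emeasure (szego_measure M) A =
    (emeasure M {x. cis (arccos x) \<in> A} + emeasure M {x. cis (- arccos x) \<in> A}) / 2"
proof -
  interpret M: prob_space M by fact
  have sp: "space M = UNIV"
    using sets_eq_imp_space_eq[OF assms(2)] by simp
  let ?p = "pmf_of_set {1, - 1 :: real}"
  let ?f = "\<lambda>(s, x). cis (s * arccos x)"
  note m = measurable_szego[OF assms(2), of ?p]
  have "emeasure (szego_measure M) A =
      emeasure (measure_pmf ?p \<Otimes>\<^sub>M M) (?f -` A \<inter> space (measure_pmf ?p \<Otimes>\<^sub>M M))"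
    unfolding szego_measure_def by (rule emeasure_distr[OF m A])
  also have "\<dots> = (\<integral>\<^sup>+s. emeasure M (Pair s -` (?f -` A \<inter> space (measure_pmf ?p \<Otimes>\<^sub>M M))) \<partial>measure_pmf ?p)"
    using measurable_sets[OF m A] by (rule M.emeasure_pair_measure_alt)
  also have "\<dots> = (\<integral>\<^sup>+s. emeasure M {x. cis (s * arccos x) \<in> A} \<partial>measure_pmf ?p)"
    by (intro nn_integral_cong arg_cong[where f = "emeasure M"]) (auto simp: space_pair_measure sp)
  also have "\<dots> = (emeasure M {x. cis (arccos x) \<in> A} + emeasure M {x. cis (- arccos x) \<in> A}) / 2"
    by (subst nn_integral_pmf_of_set) auto
  finally show ?thesis .
qed

lemma prob_space_szego_measure:
  assumes "prob_space M" and "sets M = sets borel"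
  shows "prob_space (szego_measure M)"
proof
  interpret M: prob_space M by fact
  have "space M = UNIV"
    using sets_eq_imp_space_eq[OF assms(2)] by simp
  then have "emeasure M UNIV = 1"
    using M.emeasure_space_1 by simp
  moreover have "space (szego_measure M) = UNIV"
    by (simp add: szego_measure_def)
  ultimately show "emeasure (szego_measure M) (space (szego_measure M)) = 1"
    by (simp add: emeasure_szego_measure[OF assms])
qed

lemma szego_measure_unit_circle:
  assumes "prob_space M" and "sets M = sets borel"
  shows "emeasure (szego_measure M) (- sphere 0 1) = 0"
  by (subst emeasure_szego_measure[OF assms]) (auto simp: borel_open closed_sphere open_Compl)

lemma szego_measure_cnj:
  assumes "prob_space M" and "sets M = sets borel"
  shows "distr (szego_measure M) borel cnj = szego_measure M"
proof (rule measure_eqI)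
  have cnj: "cnj \<in> borel_measurable borel"
    by (intro borel_measurable_continuous_onI) (auto intro!: continuous_intros)
  have sz: "sets (szego_measure M) = sets borel" "space (szego_measure M) = UNIV"
    by (simp_all add: szego_measure_def)
  show "sets (distr (szego_measure M) borel cnj) = sets (szego_measure M)"
    by (simp add: sz)
  fix A assume "A \<in> sets (distr (szego_measure M) borel cnj)"
  then have A: "A \<in> sets borel"
    by simp
  have B: "cnj -` A \<in> sets borel"
    using measurable_sets[OF cnj A] by simp
  have "cnj \<in> measurable (szego_measure M) borel"
    using cnj measurable_cong_sets[OF sz(1) refl] by blast
  then have "emeasure (distr (szego_measure M) borel cnj) A = emeasure (szego_measure M) (cnj -` A)"
    by (subst emeasure_distr[OF _ A]) (auto simp: sz)
  also have "\<dots> = emeasure (szego_measure M) A"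
    by (simp add: emeasure_szego_measure[OF assms A] emeasure_szego_measure[OF assms B]
        cis_cnj add.commute)
  finally show "emeasure (distr (szego_measure M) borel cnj) A = emeasure (szego_measure M) A" .
qed

lemma szego_measure_Re:
  assumes "prob_space M" and "sets M = sets borel" and "AE x in M. x \<in> {-1..1}"
  shows "distr (szego_measure M) borel Re = M"
proof (rule measure_eqI)
  have Re: "Re \<in> borel_measurable borel"
    by (intro borel_measurable_continuous_onI) (auto intro!: continuous_intros)
  have sz: "sets (szego_measure M) = sets borel" "space (szego_measure M) = UNIV"
    by (simp_all add: szego_measure_def)
  show "sets (distr (szego_measure M) borel Re) = sets M"
    by (simp add: assms)
  fix A assume "A \<in> sets (distr (szego_measure M) borel Re)"
  then have A: "A \<in> sets borel"
    by simp
  have B: "Re -` A \<in> sets borel"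
    using measurable_sets[OF Re A] by simp
  have "(\<lambda>x. cos (arccos x)) \<in> borel_measurable borel"
    by measurable
  from measurable_sets[OF this A] have C: "{x. cos (arccos x) \<in> A} \<in> sets M"
    by (simp add: assms vimage_def)
  have "Re \<in> measurable (szego_measure M) borel"
    using Re measurable_cong_sets[OF sz(1) refl] by blast
  then have "emeasure (distr (szego_measure M) borel Re) A = emeasure (szego_measure M) (Re -` A)"
    by (subst emeasure_distr[OF _ A]) (auto simp: sz)
  also have "\<dots> = (emeasure M {x. cos (arccos x) \<in> A} + emeasure M {x. cos (arccos x) \<in> A}) / 2"
    by (simp add: emeasure_szego_measure[OF assms(1,2) B])
  also have "emeasure M {x. cos (arccos x) \<in> A} = emeasure M A"
  proof (rule emeasure_eq_AE)
    show "AE x in M. x \<in> {x. cos (arccos x) \<in> A} \<longleftrightarrow> x \<in> A"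
      using assms(3) by (rule eventually_mono) auto
  qed (use A C assms(2) in auto)
  also have "(emeasure M A + emeasure M A) / 2 = emeasure M A"
    by (simp add: ennreal_mult_divide_eq flip: mult_2_right)
  finally show "emeasure (distr (szego_measure M) borel Re) A = emeasure M A" .
qed

lemma AE_in_closed_superset_msupport:
  fixes M :: "'a::second_countable_topology measure"
  assumes "sets M = sets borel" and "closed A" and "msupport M \<subseteq> A"
  shows "AE x in M. x \<in> A"
proof -
  let ?F = "{U. open U \<and> emeasure M U = 0}"
  obtain F where F: "F \<subseteq> ?F" "countable F" "\<Union>F = \<Union>?F"
    using Lindelof[of ?F] by blast
  have "AE x in M. \<forall>U\<in>F. x \<notin> U"
    using F by (subst AE_ball_countable) (auto intro!: AE_not_in simp: null_sets_def assms)
  moreover have "x \<in> A" if "\<forall>U\<in>F. x \<notin> U" for x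
  proof -
    have "x \<notin> \<Union>?F"
      using that F(3) by blast
    then have "x \<in> msupport M"
      by (auto simp: msupport_def zero_less_iff_neq_zero)
    with assms show ?thesis by blast
  qed
  ultimately show ?thesis
    by (auto elim: eventually_mono)
qed

end

theory Submission
  imports Defs
begin

text \<open>
  The claim amounts to the Geronimus relations between the Jacobi coefficients of a measure \<open>M\<close> on
  \<open>[-1, 1]\<close> and the Verblunsky coefficients of its Szego transform, applied to the shifted sequences.
  Let \<open>\<Phi>\<^sub>n\<close> be the monic orthogonal polynomials on the circle and
  \<open>R\<^sub>n(z) = (2z)\<^sup>n P\<^sub>n((z + 1/z)/2)\<close>, a monic polynomial of degree \<open>2n\<close> with constant term 1. As
  \<open>P\<^sub>n\<close> is orthogonal to the Chebyshev polynomials of degree less than \<open>n\<close>, \<open>R\<^sub>n\<close> is orthogonal to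
  \<open>z, \<dots>, z\<^sup>2\<^sup>n\<^sup>-\<^sup>1\<close>, and so are \<open>\<Phi>\<^sub>2\<^sub>n\<close> and its reversal. Hence
  \<open>(1 - \<alpha>\<^sub>2\<^sub>n\<^sub>-\<^sub>1) R\<^sub>n = \<Phi>\<^sub>2\<^sub>n + \<Phi>\<^sub>2\<^sub>n\<^sup>*\<close>: the difference lies in the span of these powers and is
  orthogonal to it. Comparing the coefficients of \<open>z\<^sup>2\<^sup>n\<^sup>-\<^sup>1\<close> gives the relation for \<open>b\<close>, comparing the
  norms gives the one for \<open>d\<close>.
\<close>

subsection \<open>Real orthogonal polynomials for a shift-invariant form\<close>


lemma sum_coeff_linear_functional:
  fixes L :: "'a::comm_semiring_1 poly \<Rightarrow> 'a"
  assumes add: "\<And>p q. L (p + q) = L p + L q" and smult: "\<And>c p. L (smult c p) = c * L p"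
  shows "L p = (\<Sum>i\<le>degree p. coeff p i * L (monom 1 i))"
proof -
  have zero: "L 0 = 0"
    using smult[of 0 0] by simp
  have "L (\<Sum>i\<in>S. monom (coeff p i) i) = (\<Sum>i\<in>S. coeff p i * L (monom 1 i))"
    if "finite S" for S
    using that
  proof (induction S rule: finite_induct)
    case (insert i S)
    have "monom (coeff p i) i = smult (coeff p i) (monom 1 i)"
      by (simp add: smult_monom)
    then show ?case
      using insert by (simp add: add smult)
  qed (simp add: zero)
  from this[of "{..degree p}"] show ?thesis
    by (simp add: poly_as_sum_of_monoms)
qed

text \<open>Models the inner product of a conjugation-invariant measure on the unit circle,
  restricted to real polynomials: its moments are real, and \<open>shift\<close> says that
  multiplication by z is an isometry.\<close>

locale toeplitz_form =
  fixes B :: "real poly \<Rightarrow> real poly \<Rightarrow> real"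
  assumes add_left: "B (p + q) r = B p r + B q r"
    and smult_left: "B (smult c p) r = c * B p r"
    and commute: "B p q = B q p"
    and shift: "B (pCons 0 p) (pCons 0 q) = B p q"
    and pos: "p \<noteq> 0 \<Longrightarrow> B p p > 0"
begin

lemma add_right: "B r (p + q) = B r p + B r q"
  using add_left commute by metis

lemma smult_right: "B r (smult c p) = c * B r p"
  using smult_left commute by metis

lemma diff_left: "B (p - q) r = B p r - B q r"
  using add_left[of "p - q" q r] by simp

lemma shift_monom: "B (monom 1 m * p) (monom 1 m * q) = B p q"
  by (induction m) (simp_all add: monom_Suc shift)

lemma sum_right: "B p q = (\<Sum>i\<le>degree q. coeff q i * B p (monom 1 i))"
  by (rule sum_coeff_linear_functional) (simp_all add: add_right smult_right)

lemma sum_right_single: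
  assumes "\<And>i. i \<noteq> m \<Longrightarrow> coeff q i * B p (monom 1 i) = 0"
  shows "B p q = coeff q m * B p (monom 1 m)"
proof (cases "m \<le> degree q")
  case True
  then show ?thesis
    using assms by (subst sum_right) (simp add: sum.remove[of _ m] sum.neutral del: mult_eq_0_iff)
next
  case False
  then have "B p q = 0"
    using assms by (subst sum_right) (auto intro!: sum.neutral)
  with False show ?thesis
    by (simp add: coeff_eq_0)
qed

text \<open>The pair consists of the monic orthogonal polynomial \<open>\<Phi>\<^sub>n\<close> and the reversed polynomial
  \<open>\<Phi>\<^sub>n\<^sup>*\<close>, built by the Szego recursion with real coefficients.\<close>

primrec opuc_pair :: "nat \<Rightarrow> real poly \<times> real poly" where
  "opuc_pair 0 = (1, 1)"
| "opuc_pair (Suc n) = (let (f, g) = opuc_pair n; a = B (pCons 0 f) 1 / B g 1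
     in (pCons 0 f - smult a g, g - smult a (pCons 0 f)))"

definition opuc :: "nat \<Rightarrow> real poly" where
  "opuc n = fst (opuc_pair n)"

definition reversed_opuc :: "nat \<Rightarrow> real poly" where
  "reversed_opuc n = snd (opuc_pair n)"

text \<open>The usual Verblunsky coefficient \<open>\<alpha>\<^sub>n\<close> is \<open>schur (Suc n)\<close>; the convention
  \<open>\<alpha>\<^sub>-\<^sub>1 = -1\<close> becomes \<open>schur 0 = -1\<close>.\<close>

definition schur :: "nat \<Rightarrow> real" where
  "schur n = - coeff (opuc n) 0"

lemma opuc_0 [simp]: "opuc 0 = 1" "reversed_opuc 0 = 1" "schur 0 = -1"
  by (simp_all add: opuc_def reversed_opuc_def schur_def)

lemma reversed_opuc_coeff_0 [simp]: "coeff (reversed_opuc n) 0 = 1"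
  by (induction n) (simp_all add: reversed_opuc_def Let_def split_beta)

text \<open>The quotient in the recursion is the value a for which z Phi_n - a Phi_n^* is orthogonal
  to 1. It is minus the constant term of Phi_(n+1) because Phi_n^* has constant term 1.\<close>

lemma schur_Suc: "schur (Suc n) = B (pCons 0 (opuc n)) 1 / B (reversed_opuc n) 1"
proof -
  have "coeff (snd (opuc_pair n)) 0 = 1"
    using reversed_opuc_coeff_0[of n] by (simp add: reversed_opuc_def)
  then show ?thesis
    by (simp add: schur_def opuc_def reversed_opuc_def Let_def split_beta)
qed

lemma opuc_Suc: "opuc (Suc n) = pCons 0 (opuc n) - smult (schur (Suc n)) (reversed_opuc n)"
  by (subst schur_Suc) (simp add: opuc_def reversed_opuc_def Let_def split_beta)

lemma reversed_opuc_Suc: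
  "reversed_opuc (Suc n) = reversed_opuc n - smult (schur (Suc n)) (pCons 0 (opuc n))"
  by (subst schur_Suc) (simp add: opuc_def reversed_opuc_def Let_def split_beta)

text \<open>On the circle this is Phi_n^*(z) = z^n cnj (Phi_n(z)); here it follows from the
  recursion alone. Both exponents stay arbitrary because the step also uses the induction hypothesis
  with \<open>j\<close> and \<open>Suc n + i\<close> in place of \<open>i\<close> and
  \<open>j\<close>.\<close>

lemma B_reversed_opuc:
  "B (monom 1 i * reversed_opuc n) (monom 1 j) = B (monom 1 j * opuc n) (monom 1 (n + i))"
proof (induction n arbitrary: i j)
  case 0
  show ?case by (simp add: commute)
next
  case (Suc n)
  let ?z = "\<lambda>m. monom (1::real) m"
  have 1: "?z m * pCons 0 p = ?z (Suc m) * p" for m p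
    by (simp add: monom_Suc)
  have "B (?z j * reversed_opuc n) (?z (Suc n + i))
      = B (?z n * (?z (Suc i) * opuc n)) (?z n * ?z j)"
    using Suc.IH[of j "Suc n + i"] by (simp add: mult_monom add.commute flip: mult.assoc)
  also have "\<dots> = B (?z (Suc i) * opuc n) (?z j)"
    by (rule shift_monom)
  finally have 2: "B (?z j * reversed_opuc n) (?z (Suc n + i)) = B (?z (Suc i) * opuc n) (?z j)" .
  have 3: "B (?z (Suc j) * opuc n) (?z (Suc n + i)) = B (?z j * opuc n) (?z (n + i))"
    by (simp add: monom_Suc shift)
  show ?case
    unfolding opuc_Suc reversed_opuc_Suc right_diff_distrib mult_smult_right diff_left smult_left 1 2 3
    by (simp only: Suc.IH)
qed

lemma B_reversed_opuc_monom: "j \<le> n \<Longrightarrow> B (reversed_opuc n) (monom 1 j) = B (opuc n) (monom 1 (n - j))"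
  using B_reversed_opuc[of 0 n j] shift_monom[of j "opuc n" "monom 1 (n - j)"]
  by (simp add: mult_monom)

lemma B_reversed_opuc_Suc: "B (reversed_opuc n) (monom 1 (Suc n)) = B (pCons 0 (opuc n)) 1"
  using B_reversed_opuc[of 0 n "Suc n"] shift_monom[of n "pCons 0 (opuc n)" 1]
  by (simp add: monom_Suc mult_monom)

lemma opuc_degree_lead:
  "degree (opuc n) = n \<and> lead_coeff (opuc n) = 1 \<and> degree (reversed_opuc n) \<le> n"
proof (induction n)
  case (Suc n)
  have "degree (smult (schur (Suc n)) (reversed_opuc n)) < Suc n"
    using Suc by (meson degree_smult_le le_imp_less_Suc le_trans)
  moreover have d: "degree (pCons 0 (opuc n)) = Suc n"
    using Suc by auto
  ultimately have "degree (opuc (Suc n)) = Suc n"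
    unfolding opuc_Suc by (metis degree_add_eq_left degree_minus diff_conv_add_uminus)
  moreover have "coeff (opuc (Suc n)) (Suc n) = 1"
    using Suc by (auto simp: opuc_Suc coeff_eq_0)
  moreover have "degree (reversed_opuc (Suc n)) \<le> Suc n"
    unfolding reversed_opuc_Suc using Suc d
    by (intro degree_diff_le) (auto intro: le_trans[OF degree_smult_le])
  ultimately show ?case by simp
qed simp

lemma opuc_degree [simp]: "degree (opuc n) = n"
  and opuc_lead_coeff [simp]: "coeff (opuc n) n = 1"
  and reversed_opuc_degree: "degree (reversed_opuc n) \<le> n"
  using opuc_degree_lead[of n] by auto

lemma reversed_opuc_coeff_top: "coeff (reversed_opuc n) n = - schur n"
proof (cases n)
  case (Suc m)
  then show ?thesis
    using reversed_opuc_degree[of m] by (simp add: reversed_opuc_Suc coeff_eq_0)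
qed simp

lemma opuc_nonzero: "opuc n \<noteq> 0"
  using opuc_lead_coeff[of n] by force

text \<open>Both claims go through one induction: the next coefficient divides by <Phi_n^*, 1>,
  which equals <Phi_n, z^n> and must be nonzero for orthogonality to 1 in the next degree.\<close>

lemma opuc_orthogonal_norm:
  "(\<forall>j<n. B (opuc n) (monom 1 j) = 0) \<and> B (opuc n) (monom 1 n) > 0"
proof (induction n)
  case 0
  then show ?case using pos[of 1] by simp
next
  case (Suc n)
  have norm: "B (reversed_opuc n) 1 > 0"
    using B_reversed_opuc_monom[of 0 n] Suc by simp
  have o: "B (opuc (Suc n)) (monom 1 j) = 0" if "j \<le> n" for j
  proof (cases j)
    case 0
    then show ?thesis
      using norm by (simp add: opuc_Suc diff_left smult_left schur_Suc)
  next
    case (Suc i)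
    have "B (pCons 0 (opuc n)) (monom 1 j) = 0"
      using \<open>j \<le> n\<close> Suc.IH Suc by (simp add: monom_Suc shift)
    moreover have "B (reversed_opuc n) (monom 1 j) = 0"
      using that Suc.IH Suc by (simp add: B_reversed_opuc_monom)
    ultimately show ?thesis
      by (simp add: opuc_Suc diff_left smult_left)
  qed
  \<comment> \<open>Only the leading monomial survives, so \<open>pos\<close> transfers to the
    pairing with z^(n+1).\<close>
  then have "B (opuc (Suc n)) (opuc (Suc n)) = coeff (opuc (Suc n)) (Suc n) * B (opuc (Suc n)) (monom 1 (Suc n))"
    by (intro sum_right_single) (metis coeff_eq_0 linorder_neqE_nat mult_eq_0_iff less_Suc_eq_le opuc_degree)
  with pos[OF opuc_nonzero[of "Suc n"]] o show ?case
    by simp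
qed

lemma opuc_orthogonal_monom: "j < n \<Longrightarrow> B (opuc n) (monom 1 j) = 0"
  using opuc_orthogonal_norm by blast

lemma reversed_opuc_orthogonal_monom:
  "0 < j \<Longrightarrow> j \<le> n \<Longrightarrow> B (reversed_opuc n) (monom 1 j) = 0"
  by (simp add: B_reversed_opuc_monom opuc_orthogonal_monom)

lemma opuc_orthogonal: "degree p < n \<Longrightarrow> B (opuc n) p = 0"
  by (subst sum_right) (simp add: opuc_orthogonal_monom)

definition opuc_norm :: "nat \<Rightarrow> real" where
  "opuc_norm n = B (opuc n) (monom 1 n)"

lemma opuc_norm_pos: "opuc_norm n > 0"
  using opuc_orthogonal_norm by (simp add: opuc_norm_def)

lemma B_reversed_opuc_1: "B (reversed_opuc n) 1 = opuc_norm n"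
  using B_reversed_opuc_monom[of 0 n] by (simp add: opuc_norm_def)

text \<open>Pair the recursion with z^(n+1): the shifted term gives the old norm, and <Phi_n^*,
  z^(n+1)> = <z Phi_n, 1> is the new coefficient times the old norm.\<close>

lemma opuc_norm_Suc: "opuc_norm (Suc n) = (1 - (schur (Suc n))\<^sup>2) * opuc_norm n"
proof -
  have "B (pCons 0 (opuc n)) 1 = schur (Suc n) * opuc_norm n"
    using opuc_norm_pos[of n] by (simp add: schur_Suc B_reversed_opuc_1)
  then have "opuc_norm (Suc n) = opuc_norm n - schur (Suc n) * (schur (Suc n) * opuc_norm n)"
    using B_reversed_opuc_Suc
    by (simp add: opuc_norm_def opuc_Suc diff_left smult_left) (simp add: monom_Suc shift)
  then show ?thesis
    by (simp add: power2_eq_square algebra_simps)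
qed

lemma schur_square_less_1: "n > 0 \<Longrightarrow> (schur n)\<^sup>2 < 1"
  using opuc_norm_Suc[of "n - 1"] opuc_norm_pos[of n] opuc_norm_pos[of "n - 1"]
  by (auto simp: zero_less_mult_iff)

text \<open>This includes the value -1 at \<open>n = 0\<close>, so factors 1 -
  \<open>schur n\<close> can be cancelled at every index.\<close>

lemma schur_less_1: "schur n < 1"
  using schur_square_less_1[of n] abs_square_less_1[of "schur n"] by (cases "n = 0") auto

lemma opuc_subleading:
  "coeff (opuc (Suc (Suc n))) (Suc n)
     = coeff (opuc (Suc n)) n + schur (Suc (Suc n)) * schur (Suc n)"
  by (simp add: opuc_Suc[of "Suc n"] reversed_opuc_coeff_top)

lemma reversed_opuc_subleading:
  "coeff (reversed_opuc (Suc (Suc n))) (Suc n)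
     = - schur (Suc n) - schur (Suc (Suc n)) * coeff (opuc (Suc n)) n"
  by (simp add: reversed_opuc_Suc[of "Suc n"] reversed_opuc_coeff_top)

end


text \<open>\<open>geronimus_poly b d n\<close> is \<open>(2z)\<^sup>n P\<^sub>n((z + 1/z)/2)\<close> for \<open>P\<^sub>n = recurrence_poly b d n\<close>.\<close>

fun geronimus_poly :: "(int \<Rightarrow> real) \<Rightarrow> (int \<Rightarrow> real) \<Rightarrow> nat \<Rightarrow> real poly" where
  "geronimus_poly b d 0 = 1"
| "geronimus_poly b d (Suc 0) = [:1, - 2 * b 1, 1:]"
| "geronimus_poly b d (Suc (Suc n)) =
     [:1, - 2 * b (int n + 2), 1:] * geronimus_poly b d (Suc n)
     - smult (4 * d (int n + 1)) (pCons 0 (pCons 0 (geronimus_poly b d n)))"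

lemma geronimus_poly_coeff_0: "coeff (geronimus_poly b d n) 0 = 1"
  by (induction b d n rule: geronimus_poly.induct) (simp_all add: coeff_mult)

lemma geronimus_poly_degree_lead:
  "degree (geronimus_poly b d n) \<le> 2 * n \<and> coeff (geronimus_poly b d n) (2 * n) = 1"
proof (induction b d n rule: geronimus_poly.induct)
  case (3 b d n)
  let ?R = "geronimus_poly b d"
  have "degree (pCons 0 (pCons 0 (?R n))) \<le> 2 * n + 2"
    using 3 by (auto intro!: degree_pCons_le[THEN le_trans])
  moreover have "degree ([:1, - 2 * b (int n + 2), 1:] * ?R (Suc n)) \<le> 2 + (2 * n + 2)"
    using 3 by (intro degree_mult_le[THEN le_trans] add_mono) auto
  ultimately have "degree (?R (Suc (Suc n))) \<le> 2 * n + 4"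
    by (auto intro!: degree_diff_le degree_smult_le[THEN le_trans])
  moreover have "coeff (?R n) (Suc (Suc (2 * n))) = 0" "coeff (?R (Suc n)) (Suc (Suc (Suc (2 * n)))) = 0"
    "coeff (?R (Suc n)) (Suc (Suc (Suc (Suc (2 * n))))) = 0"
    using 3 by (auto intro!: coeff_eq_0)
  ultimately show ?case
    using 3 by (simp add: coeff_pCons split: nat.split)
qed (auto simp: numeral_2_eq_2)

text \<open>The term with \<open>d\<close> has degree at most 2n + 2 and does not reach this
  coefficient.\<close>

lemma geronimus_poly_subleading:
  "coeff (geronimus_poly b d (Suc (Suc n))) (2 * n + 3)
     = coeff (geronimus_poly b d (Suc n)) (2 * n + 1) - 2 * b (int n + 2)"
proof -
  have "coeff (geronimus_poly b d n) (Suc (2 * n)) = 0"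
    "coeff (geronimus_poly b d (Suc n)) (Suc (Suc (Suc (2 * n)))) = 0"
    "coeff (geronimus_poly b d (Suc n)) (Suc (Suc (2 * n))) = 1"
    using geronimus_poly_degree_lead[of b d n] geronimus_poly_degree_lead[of b d "Suc n"]
    by (auto intro!: coeff_eq_0)
  then show ?thesis
    by (simp add: numeral_3_eq_3)
qed

section \<open>Geronimus relations for an abstract Toeplitz form\<close>

context toeplitz_form
begin

text \<open>The scalar is forced at both ends: Phi_2n + Phi_2n^* has constant term and leading
  coefficient 1 - \<open>schur (2 * n)\<close>, while \<open>geronimus_poly\<close> has 1 in both
  places.\<close>

lemma geronimus_poly_eq_opuc:
  assumes orth: "\<And>j. 0 < j \<Longrightarrow> j < 2 * n \<Longrightarrow> B (geronimus_poly b d n) (monom 1 j) = 0"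
  shows "smult (1 - schur (2 * n)) (geronimus_poly b d n) = opuc (2 * n) + reversed_opuc (2 * n)"
proof -
  let ?R = "geronimus_poly b d n"
  define F where "F = smult (1 - schur (2 * n)) ?R - (opuc (2 * n) + reversed_opuc (2 * n))"
  have "degree F \<le> 2 * n"
    unfolding F_def using geronimus_poly_degree_lead[of b d n] reversed_opuc_degree[of "2 * n"]
    by (intro degree_diff_le degree_add_le) (auto intro: le_trans[OF degree_smult_le])
  moreover have "coeff F (2 * n) = 0"
    unfolding F_def using geronimus_poly_degree_lead[of b d n] by (simp add: reversed_opuc_coeff_top)
  moreover have "coeff F 0 = 0"
    unfolding F_def by (simp add: geronimus_poly_coeff_0) (simp add: schur_def)
  ultimately have c: "coeff F i = 0" if "i = 0 \<or> i \<ge> 2 * n" for i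
    using that by (metis coeff_eq_0 le_less_trans le_neq_implies_less)
  have "coeff F i * B F (monom 1 i) = 0" for i
  proof (cases "i = 0 \<or> i \<ge> 2 * n")
    case False
    then have "B F (monom 1 i) = 0"
      using orth[of i] by (simp add: F_def diff_left add_left smult_left
          opuc_orthogonal_monom reversed_opuc_orthogonal_monom)
    then show ?thesis by simp
  qed (simp add: c)
  then have "B F F = 0"
    by (subst sum_right) (intro sum.neutral ballI)
  then have "F = 0"
    using pos[of F] by force
  then show ?thesis
    by (simp add: F_def)
qed

text \<open>Pair the preceding identity with R_n itself. Against Phi_2n only the monomial z^(2n) of
  R_n survives, against Phi_2n^* only the constant; each contributes one
  \<open>opuc_norm (2 * n)\<close>.\<close>

lemma geronimus_poly_norm:
  assumes orth: "\<And>j. 0 < j \<Longrightarrow> j < 2 * n \<Longrightarrow> B (geronimus_poly b d n) (monom 1 j) = 0"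
  shows "(1 - schur (2 * n)) * B (geronimus_poly b d n) (geronimus_poly b d n) = 2 * opuc_norm (2 * n)"
proof -
  let ?R = "geronimus_poly b d n"
  have "B (opuc (2 * n)) ?R = coeff ?R (2 * n) * B (opuc (2 * n)) (monom 1 (2 * n))"
    using geronimus_poly_degree_lead[of b d n]
    by (intro sum_right_single)
       (metis coeff_eq_0 le_less_trans linorder_neqE_nat mult_eq_0_iff opuc_orthogonal_monom)
  moreover have "B (reversed_opuc (2 * n)) ?R = coeff ?R 0 * B (reversed_opuc (2 * n)) (monom 1 0)"
    using geronimus_poly_degree_lead[of b d n]
    by (intro sum_right_single)
       (metis bot_nat_0.not_eq_extremum coeff_eq_0 le_less_trans linorder_not_less mult_eq_0_iff
         reversed_opuc_orthogonal_monom)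
  ultimately show ?thesis
    using geronimus_poly_eq_opuc[OF orth] geronimus_poly_degree_lead[of b d n]
    by (simp add: geronimus_poly_coeff_0 B_reversed_opuc_1 opuc_norm_def add_left
        flip: smult_left)
qed

text \<open>Divide the norm identities for n + 1 and n; the norms on the circle then change by two
  factors from \<open>opuc_norm_Suc\<close>. One factor 1 - \<open>schur (2 * n + 2)\<close>
  cancels.\<close>

theorem geronimus_relation_d:
  assumes orth: "\<And>n j. 0 < j \<Longrightarrow> j < 2 * n \<Longrightarrow> B (geronimus_poly b d n) (monom 1 j) = 0"
    and norm: "B (geronimus_poly b d (Suc n)) (geronimus_poly b d (Suc n))
      = 4 * c * B (geronimus_poly b d n) (geronimus_poly b d n)"
  shows "4 * c = (1 - schur (2 * n)) * (1 - (schur (2 * n + 1))\<^sup>2) * (1 + schur (2 * n + 2))"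
proof -
  let ?R = "\<lambda>n. B (geronimus_poly b d n) (geronimus_poly b d n)"
  let ?s = "\<lambda>i. schur (2 * n + i)"
  note N = geronimus_poly_norm[OF orth]
  have "?R n > 0"
    using geronimus_poly_coeff_0[of b d n] by (intro pos) auto
  have "(1 - ?s 0) * ((1 - ?s 2) * ?R (Suc n)) = 4 * c * (1 - ?s 2) * ((1 - ?s 0) * ?R n)"
    by (simp add: norm)
  moreover have "(1 - ?s 2) * ?R (Suc n) = (1 - (?s 2)\<^sup>2) * (1 - (?s 1)\<^sup>2) * ((1 - ?s 0) * ?R n)"
    using N[of "Suc n"] N[of n] opuc_norm_Suc[of "Suc (2 * n)"] opuc_norm_Suc[of "2 * n"] by simp
  ultimately have "(1 - ?s 0) * ((1 - (?s 2)\<^sup>2) * (1 - (?s 1)\<^sup>2)) * ((1 - ?s 0) * ?R n)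
      = 4 * c * (1 - ?s 2) * ((1 - ?s 0) * ?R n)"
    by (metis mult.assoc)
  then have "(1 - ?s 0) * ((1 - (?s 2)\<^sup>2) * (1 - (?s 1)\<^sup>2)) = 4 * c * (1 - ?s 2)"
    using \<open>?R n > 0\<close> schur_less_1[of "2 * n + 0"] by simp
  then have "(1 - ?s 2) * ((1 - ?s 0) * (1 - (?s 1)\<^sup>2) * (1 + ?s 2)) = (1 - ?s 2) * (4 * c)"
    by (simp add: power2_eq_square algebra_simps)
  then show ?thesis
    using schur_less_1[of "2 * n + 2"] by simp
qed

text \<open>With c the subleading coefficient of Phi_(2n+1), s = \<open>schur (2 * n + 1)\<close>
  and t = \<open>schur (2 * n + 2)\<close>, the two summands give (c + t s) + (- s - t c) = (1 -
  t)(c - s).\<close>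

lemma geronimus_poly_subleading_schur:
  assumes orth: "\<And>n j. 0 < j \<Longrightarrow> j < 2 * n \<Longrightarrow> B (geronimus_poly b d n) (monom 1 j) = 0"
  shows "coeff (geronimus_poly b d (Suc n)) (2 * n + 1)
    = coeff (opuc (2 * n + 1)) (2 * n) - schur (2 * n + 1)"
proof -
  have "(1 - schur (2 * n + 2)) * coeff (geronimus_poly b d (Suc n)) (2 * n + 1)
    = (1 - schur (2 * n + 2)) * (coeff (opuc (2 * n + 1)) (2 * n) - schur (2 * n + 1))"
    using arg_cong[OF geronimus_poly_eq_opuc[OF orth, of "Suc n"], of "\<lambda>p. coeff p (2 * n + 1)"]
      opuc_subleading[of "2 * n"] reversed_opuc_subleading[of "2 * n"]
    by (simp add: algebra_simps)
  then show ?thesis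
    using schur_less_1[of "2 * n + 2"] by simp
qed

theorem geronimus_relation_b_0:
  assumes orth: "\<And>n j. 0 < j \<Longrightarrow> j < 2 * n \<Longrightarrow> B (geronimus_poly b d n) (monom 1 j) = 0"
  shows "schur 1 = b 1"
  using geronimus_poly_subleading_schur[OF orth, of 0] by (simp add: schur_def)

text \<open>The difference of the subleading coefficients of R_(n+2) and R_(n+1) is -2 b_(n+2); on
  the circle side, two steps of \<open>opuc_subleading\<close> cancel the unknown
  coefficient.\<close>

theorem geronimus_relation_b:
  assumes orth: "\<And>n j. 0 < j \<Longrightarrow> j < 2 * n \<Longrightarrow> B (geronimus_poly b d n) (monom 1 j) = 0"
  shows "2 * b (int n + 2) = (1 - schur (2 * n + 2)) * schur (2 * n + 3)
    - (1 + schur (2 * n + 2)) * schur (2 * n + 1)"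
  using geronimus_poly_subleading[of b d n] geronimus_poly_subleading_schur[OF orth, of n]
    geronimus_poly_subleading_schur[OF orth, of "Suc n"]
    opuc_subleading[of "2 * n"] opuc_subleading[of "2 * n + 1"]
  by (simp add: algebra_simps numeral_3_eq_3)

end

subsection \<open>Polynomials on the line and on the circle\<close>


lemma degree_less_or_zero:
  assumes "degree p \<le> n" and "coeff p n = 0"
  shows "p = 0 \<or> degree p < n"
  using assms by (metis le_neq_implies_less leading_coeff_0_iff)

text \<open>Serves to pass from orthogonality within a monic sequence to orthogonality against all
  lower degrees, on the line and on the circle. Subtracting a multiple of \<open>P n\<close> lowers
  the degree.\<close>

lemma monic_sequence_span_induct:
  fixes P :: "nat \<Rightarrow> 'a::comm_ring_1 poly"
  assumes monic: "\<And>n. degree (P n) = n \<and> lead_coeff (P n) = 1"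
    and "degree p < n"
    and zero: "Q 0"
    and add: "\<And>p q. Q p \<Longrightarrow> Q q \<Longrightarrow> Q (p + q)"
    and smult: "\<And>c p. Q p \<Longrightarrow> Q (smult c p)"
    and base: "\<And>m. m < n \<Longrightarrow> Q (P m)"
  shows "Q p"
  using assms(2) base
proof (induction n arbitrary: p)
  case (Suc n)
  define q where "q = p - smult (coeff p n) (P n)"
  have "coeff (P n) n = 1"
    using monic[of n] by metis
  then have "coeff q n = 0"
    by (simp add: q_def)
  moreover have "degree q \<le> n"
    unfolding q_def using Suc.prems(1) monic[of n]
    by (intro degree_diff_le) (auto intro: le_trans[OF degree_smult_le])
  \<comment> \<open>A remainder of degree 0 with \<open>n = 0\<close> is the zero polynomial, whose
    degree is not below \<open>n\<close>; \<open>zero\<close> covers it.\<close>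
  ultimately have "Q q"
    using degree_less_or_zero[of q n] zero Suc.IH Suc.prems(2) by fastforce
  moreover have "Q (smult (coeff p n) (P n))"
    using Suc.prems(2) smult by blast
  ultimately have "Q (q + smult (coeff p n) (P n))"
    by (rule add)
  then show ?case
    by (simp add: q_def)
qed simp

text \<open>These are the Chebyshev polynomials of the first kind, built by T_(m+2) = 2 x T_(m+1) -
  T_m.\<close>

lemma cos_multiple_poly: "\<exists>T::real poly. degree T \<le> n \<and> (\<forall>t. poly T (cos t) = cos (real n * t))"
proof (induction n rule: less_induct)
  case (less n)
  consider "n = 0" | "n = 1" | m where "n = Suc (Suc m)"
    by (metis One_nat_def not0_implies_Suc)
  then show ?case
  proof cases
    case 1
    then show ?thesis by (intro exI[of _ 1]) simp
  next
    case 2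
    then show ?thesis by (intro exI[of _ "[:0, 1:]"]) simp
  next
    case 3
    obtain T U where T: "degree T \<le> Suc m" "\<And>t. poly T (cos t) = cos (real (Suc m) * t)"
      and U: "degree U \<le> m" "\<And>t. poly U (cos t) = cos (real m * t)"
      using less.IH[of "Suc m"] less.IH[of m] 3 by auto
    let ?V = "pCons 0 (smult 2 T) - U"
    have "degree ?V \<le> n"
      using T(1) U(1) 3 degree_smult_le[of 2 T] by (intro degree_diff_le degree_pCons_le[THEN le_trans]) auto
    moreover have "poly ?V (cos t) = cos (real n * t)" for t
      using cos_times_cos[of "real (Suc m) * t" t]
      by (simp add: T(2) U(2) 3 algebra_simps)
    ultimately show ?thesis by blast
  qed
qed

abbreviation complex_poly :: "real poly \<Rightarrow> complex poly" where
  "complex_poly \<equiv> map_poly of_real"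

lemma complex_poly_add: "complex_poly (p + q) = complex_poly p + complex_poly q"
  and complex_poly_diff: "complex_poly (p - q) = complex_poly p - complex_poly q"
  by (simp_all add: poly_eq_iff coeff_map_poly)

lemma complex_poly_smult: "complex_poly (smult c p) = smult (of_real c) (complex_poly p)"
  by (simp add: poly_eq_iff coeff_map_poly)

lemma complex_poly_pCons: "complex_poly (pCons c p) = pCons (of_real c) (complex_poly p)"
  by (simp add: map_poly_pCons)

lemma complex_poly_cnj: "poly (complex_poly p) (cnj z) = cnj (poly (complex_poly p) z)"
  by (induction p) (simp_all add: complex_poly_pCons)

lemma complex_poly_degree [simp]: "degree (complex_poly p) = degree p"
  by (rule degree_map_poly) simp


text \<open>On the circle 1/z = cnj z, so 1 + z^2 = 2 z Re z. This turns each quadratic factor into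
  2 z (Re z - b) and matches the two recurrences.\<close>

lemma complex_geronimus_poly:
  assumes "norm z = 1"
  shows "poly (complex_poly (geronimus_poly b d n)) z
    = (2 * z) ^ n * of_real (poly (recurrence_poly b d n) (Re z))"
proof -
  have "z * cnj z = 1"
    using assms by (simp flip: complex_norm_square)
  moreover have "z + cnj z = 2 * of_real (Re z)"
    by (simp add: complex_add_cnj)
  ultimately have z: "1 + z * z = 2 * z * of_real (Re z)"
    by (metis distrib_left add.commute mult.assoc mult.left_commute)
  show ?thesis
  proof (induction b d n rule: geronimus_poly.induct)
    case (2 b d)
    have "1 + z * (z - 2 * of_real (b 1)) = 2 * z * of_real (Re z - b 1)"
      using z by (simp add: algebra_simps)
    then show ?case
      by (simp add: complex_poly_pCons)
  next
    case (3 b d n)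
    let ?R = "\<lambda>n. poly (complex_poly (geronimus_poly b d n)) z"
    let ?P = "\<lambda>n. complex_of_real (poly (recurrence_poly b d n) (Re z))"
    have q: "1 + z * (z - 2 * of_real (b (int n + 2))) = 2 * z * of_real (Re z - b (int n + 2))"
      using z by (simp add: algebra_simps)
    have "[:1, - 2 * c, 1:] * p = p - smult (2 * c) (pCons 0 p) + pCons 0 (pCons 0 p)"
      for c :: real and p
      by (simp add: algebra_simps)
    then have "?R (Suc (Suc n)) = (1 + z * (z - 2 * of_real (b (int n + 2)))) * ?R (Suc n)
        - 4 * of_real (d (int n + 1)) * z\<^sup>2 * ?R n"
      by (simp add: complex_poly_add complex_poly_diff complex_poly_smult complex_poly_pCons
          power2_eq_square algebra_simps)
    also have "\<dots> = (2 * z) ^ Suc (Suc n) * ?P (Suc (Suc n))"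
      unfolding q 3 by (simp add: power2_eq_square algebra_simps)
    finally show ?case .
  qed simp
qed

lemma bounded_on_circle:
  fixes f :: "complex \<Rightarrow> 'a::real_normed_vector"
  assumes "continuous_on UNIV f"
  obtains K where "\<And>z. norm z = 1 \<Longrightarrow> norm (f z) \<le> K"
proof -
  have "compact (f ` sphere 0 1)"
    using continuous_on_subset[OF assms subset_UNIV] by (rule compact_continuous_image) simp
  from compact_imp_bounded[OF this] obtain K where "\<forall>y\<in>f ` sphere 0 1. norm y \<le> K"
    unfolding bounded_iff by blast
  then have "norm (f z) \<le> K" if "norm z = 1" for z
    using that by simp
  then show ?thesis
    by (rule that)
qed

section \<open>Integration against the Szego transform\<close>

locale szego_transform = prob_space M for M :: "real measure" +
  assumes sets_M: "sets M = sets borel"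
    and AE_interval: "AE x in M. x \<in> {-1..1}"
begin

text \<open>The point of the upper half circle above \<open>x\<close> if \<open>x\<close> lies in
  [-1, 1]; for other \<open>x\<close> it still has modulus 1, so bounds on the circle apply
  everywhere.\<close>

definition upper :: "real \<Rightarrow> complex" where
  "upper x = cis (arccos x)"

lemma norm_upper [simp]: "norm (upper x) = 1"
  by (simp add: upper_def)

lemma upper_mult_cnj [simp]: "upper x * cnj (upper x) = 1"
  by (simp flip: complex_norm_square)

lemma Re_upper: "x \<in> {-1..1} \<Longrightarrow> Re (upper x) = x"
  by (simp add: upper_def)

lemma measurable_upper: "upper \<in> borel_measurable M"
proof -
  have "cis \<in> borel_measurable borel"
    by (intro borel_measurable_continuous_onI) (auto intro!: continuous_intros)
  then have "upper \<in> borel_measurable borel"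
    unfolding upper_def by measurable
  then show ?thesis
    by (simp add: measurable_cong_sets[OF sets_M refl])
qed

lemma integrable_upper:
  fixes f :: "complex \<Rightarrow> 'a::{banach, second_countable_topology}"
  assumes "continuous_on UNIV f"
  shows "integrable M (\<lambda>x. f (upper x))"
proof -
  obtain K where "\<And>z. norm z = 1 \<Longrightarrow> norm (f z) \<le> K"
    using bounded_on_circle[OF assms] by blast
  then have "AE x in M. norm (f (upper x)) \<le> K"
    by (intro AE_I2) simp
  moreover have "(\<lambda>x. f (upper x)) \<in> borel_measurable M"
    using borel_measurable_continuous_onI[OF assms] measurable_upper by measurable
  ultimately show ?thesis
    by (rule integrable_const_bound)
qed

text \<open>Fubini over the fair coin: the signs 1 and -1 give \<open>upper x\<close> and its
  conjugate.\<close>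

lemma integral_szego_measure:
  fixes f :: "complex \<Rightarrow> 'a::{banach, second_countable_topology}"
  assumes "continuous_on UNIV f"
  shows "(\<integral>z. f z \<partial>szego_measure M) = (\<integral>x. (1/2) *\<^sub>R (f (upper x) + f (cnj (upper x))) \<partial>M)"
proof -
  let ?p = "pmf_of_set {1, - 1 :: real}"
  let ?g = "\<lambda>(s, x). cis (s * arccos x)"
  have f: "f \<in> borel_measurable borel"
    using assms by (rule borel_measurable_continuous_onI)
  have g: "?g \<in> borel_measurable (measure_pmf ?p \<Otimes>\<^sub>M M)"
    by (rule measurable_szego[OF sets_M])
  interpret pair_sigma_finite "measure_pmf ?p" M
    by unfold_locales
  interpret pair: prob_space "measure_pmf ?p \<Otimes>\<^sub>M M"
    by (rule prob_space_pair) (rule prob_space_axioms measure_pmf.prob_space_axioms)+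
  obtain K where K: "\<And>z. norm z = 1 \<Longrightarrow> norm (f z) \<le> K"
    using bounded_on_circle[OF assms] by blast
  have int: "integrable (measure_pmf ?p \<Otimes>\<^sub>M M) (\<lambda>(s, x). f (cis (s * arccos x)))"
    using measurable_compose[OF g f] K
    by (intro pair.integrable_const_bound[of _ K]) (auto simp: split_beta)
  have cnj: "cis (- arccos x) = cnj (upper x)" for x
    by (simp add: upper_def cis_cnj)
  have cont: "continuous_on UNIV (\<lambda>z. f (cnj z))"
    by (intro continuous_on_compose2[OF assms]) (auto intro!: continuous_intros)
  have "(\<integral>z. f z \<partial>szego_measure M) = (\<integral>q. f (?g q) \<partial>(measure_pmf ?p \<Otimes>\<^sub>M M))"
    unfolding szego_measure_def by (rule integral_distr[OF g f])
  also have "\<dots> = (\<integral>s. (\<integral>x. f (cis (s * arccos x)) \<partial>M) \<partial>measure_pmf ?p)"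
    using integral_fst'[OF int] by (simp add: case_prod_unfold)
  also have "\<dots> = (1/2) *\<^sub>R ((\<integral>x. f (upper x) \<partial>M) + (\<integral>x. f (cnj (upper x)) \<partial>M))"
    by (subst integral_measure_pmf[of "{1, -1}"])
       (auto simp: cnj upper_def scaleR_add_right)
  also have "\<dots> = (\<integral>x. (1/2) *\<^sub>R (f (upper x) + f (cnj (upper x))) \<partial>M)"
    using integrable_upper[OF assms] integrable_upper[OF cont] by simp
  finally show ?thesis .
qed

lemma integrable_szego_measure:
  fixes f :: "complex \<Rightarrow> complex"
  assumes "continuous_on UNIV f"
  shows "integrable (szego_measure M) f"
proof -
  interpret sz: prob_space "szego_measure M"
    by (rule prob_space_szego_measure[OF prob_space_axioms sets_M])
  obtain K where K: "\<And>z. norm z = 1 \<Longrightarrow> norm (f z) \<le> K"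
    using bounded_on_circle[OF assms] by blast
  have "AE z in szego_measure M. z \<notin> - sphere 0 1"
    using szego_measure_unit_circle[OF prob_space_axioms sets_M]
    by (intro AE_not_in) (auto simp: null_sets_def szego_measure_def borel_open open_Compl)
  then have "AE z in szego_measure M. norm (f z) \<le> K"
    by eventually_elim (simp add: K)
  moreover have "f \<in> borel_measurable (szego_measure M)"
    using borel_measurable_continuous_onI[OF assms] by (simp add: szego_measure_def)
  ultimately show ?thesis
    by (rule sz.integrable_const_bound)
qed

text \<open>The lower half circle contributes the conjugate integrand for real coefficients, so
  averaging both halves leaves the real part over the upper half.\<close>

definition form :: "real poly \<Rightarrow> real poly \<Rightarrow> real" where
  "form p q = (\<integral>x. Re (poly (complex_poly p) (upper x) * cnj (poly (complex_poly q) (upper x))) \<partial>M)"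

lemma form_eq_integral_szego:
  "(\<integral>z. poly (complex_poly p) z * cnj (poly (complex_poly q) z) \<partial>szego_measure M) = of_real (form p q)"
proof -
  let ?f = "\<lambda>z. poly (complex_poly p) z * cnj (poly (complex_poly q) z)"
  have "(\<integral>z. ?f z \<partial>szego_measure M) = (\<integral>x. (1/2) *\<^sub>R (?f (upper x) + ?f (cnj (upper x))) \<partial>M)"
    by (intro integral_szego_measure continuous_intros)
  also have "\<dots> = (\<integral>x. complex_of_real (Re (?f (upper x))) \<partial>M)"
    by (intro Bochner_Integration.integral_cong refl) (simp add: complex_poly_cnj complex_eq_iff)
  finally show ?thesis
    by (simp only: integral_complex_of_real form_def)
qed

lemma integrable_form:
  "integrable M (\<lambda>x. Re (poly (complex_poly p) (upper x) * cnj (poly (complex_poly q) (upper x))))"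
  by (intro integrable_upper[of "\<lambda>z. Re (poly (complex_poly p) z * cnj (poly (complex_poly q) z))"]
      continuous_intros)

end

section \<open>The Toeplitz form of a measure with given Jacobi coefficients\<close>

locale jacobi_measure = szego_transform +
  fixes b d :: "int \<Rightarrow> real"
  assumes coeffs: "recurrence_coeffs M b d"
begin

abbreviation P :: "nat \<Rightarrow> real poly" where
  "P \<equiv> recurrence_poly b d"

lemma P_monic: "degree (P n) = n \<and> lead_coeff (P n) = 1"
  and P_orthogonal: "m \<noteq> n \<Longrightarrow> (\<integral>x. poly (P m) x * poly (P n) x \<partial>M) = 0"
  and integrable_power: "integrable M (\<lambda>x. x ^ n)"
  and d_pos: "i \<ge> 1 \<Longrightarrow> d i > 0"
  using coeffs unfolding recurrence_coeffs_def monic_orthogonal_line_def by blast+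

lemma integrable_poly: "integrable M (poly p)"
proof -
  have "integrable M (\<lambda>x. \<Sum>i\<le>degree p. coeff p i * x ^ i)"
    using integrable_power by simp
  then show ?thesis
    by (simp add: poly_altdef[abs_def])
qed

lemma P_orthogonal_less: "degree p < n \<Longrightarrow> (\<integral>x. poly (P n * p) x \<partial>M) = 0"
proof (rule monic_sequence_span_induct[of P p n], goal_cases)
  case (4 p q)
  then show ?case
    using integrable_poly[of "P n * p"] integrable_poly[of "P n * q"]
    by (simp add: distrib_left del: poly_mult)
next
  case (5 c p)
  then show ?case by simp
next
  case (6 m)
  then show ?case
    using P_orthogonal[of n m] by simp
qed ((rule P_monic | assumption | simp)+)

lemma P_orthogonal_top:
  assumes "degree p \<le> n"
  shows "(\<integral>x. poly (P n * p) x \<partial>M) = coeff p n * (\<integral>x. poly (P n * P n) x \<partial>M)"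
proof -
  define q where "q = p - smult (coeff p n) (P n)"
  have "coeff (P n) n = 1"
    using P_monic[of n] by metis
  then have "coeff q n = 0"
    by (simp add: q_def)
  moreover have "degree q \<le> n"
    unfolding q_def using assms P_monic[of n]
    by (intro degree_diff_le) (auto intro: le_trans[OF degree_smult_le])
  ultimately have "(\<integral>x. poly (P n * q) x \<partial>M) = 0"
    using degree_less_or_zero[of q n] P_orthogonal_less[of q n] by auto
  moreover have "P n * p = P n * q + smult (coeff p n) (P n * P n)"
    by (simp add: q_def algebra_simps)
  ultimately show ?thesis
    using integrable_poly[of "P n * q"] integrable_poly[of "P n * P n"] by (simp del: poly_mult)
qed

definition P_norm :: "nat \<Rightarrow> real" where
  "P_norm n = (\<integral>x. poly (P n * P n) x \<partial>M)"

lemma P_norm_0: "P_norm 0 = 1"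
  by (simp add: P_norm_def prob_space)

text \<open>Evaluate the integral of x P_n P_(n+1) in two ways: x P_n has leading part P_(n+1), and
  x P_(n+1) expands by the recurrence, where only the \<open>d\<close> term meets P_n.\<close>

lemma P_norm_Suc: "P_norm (Suc n) = d (int n + 1) * P_norm n"
proof -
  have "coeff (P n) n = 1"
    using P_monic[of n] by metis
  then have "P_norm (Suc n) = (\<integral>x. poly (P (Suc n) * pCons 0 (P n)) x \<partial>M)"
    using P_monic[of n]
    by (subst P_orthogonal_top) (simp_all add: P_norm_def del: poly_mult recurrence_poly.simps)
  also have "P (Suc n) * pCons 0 (P n)
      = P (Suc (Suc n)) * P n + smult (b (int n + 2)) (P (Suc n) * P n) + smult (d (int n + 1)) (P n * P n)"
    by (simp add: algebra_simps)
  also have "(\<integral>x. poly \<dots> x \<partial>M) = (\<integral>x. poly (P (Suc (Suc n)) * P n) x \<partial>M)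
      + b (int n + 2) * (\<integral>x. poly (P (Suc n) * P n) x \<partial>M) + d (int n + 1) * P_norm n"
    using integrable_poly unfolding P_norm_def poly_add poly_smult
    by (simp del: poly_mult recurrence_poly.simps)
  also have "\<dots> = d (int n + 1) * P_norm n"
    using P_orthogonal_less[of "P n" "Suc (Suc n)"] P_orthogonal_less[of "P n" "Suc n"] P_monic[of n]
    by (simp del: recurrence_poly.simps poly_mult)
  finally show ?thesis .
qed

lemma P_norm_pos: "P_norm n > 0"
  by (induction n) (simp_all add: P_norm_0 P_norm_Suc d_pos)

text \<open>Otherwise \<open>M\<close> would live on the finitely many real parts of roots of
  \<open>f\<close>. A monic real \<open>p\<close> vanishing there, tested against
  \<open>P (degree p)\<close>, would make \<open>P_norm (degree p)\<close> zero.\<close>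

lemma poly_upper_not_AE_0:
  assumes "f \<noteq> 0"
  shows "\<not> (AE x in M. poly f (upper x) = 0)"
proof
  assume AE: "AE x in M. poly f (upper x) = 0"
  let ?S = "Re ` {z. poly f z = 0}"
  have fin: "finite ?S"
    using poly_roots_finite[OF assms] by simp
  define p where "p = (\<Prod>s\<in>?S. [:- s, 1:])"
  have "lead_coeff p = 1"
    by (simp add: p_def lead_coeff_prod)
  have "AE x in M. poly (P (degree p) * p) x = 0"
    using AE AE_interval
  proof eventually_elim
    case (elim x)
    then have "x \<in> ?S"
      using Re_upper[of x] by (intro image_eqI[of _ _ "upper x"]) simp_all
    then have "poly p x = 0"
      unfolding p_def poly_prod using fin by (intro prod_zero) auto
    then show ?case by simp
  qed
  then have "(\<integral>x. poly (P (degree p) * p) x \<partial>M) = 0"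
    by (rule integral_eq_zero_AE)
  then show False
    using P_orthogonal_top[of p "degree p"] P_norm_pos[of "degree p"] \<open>lead_coeff p = 1\<close>
    by (simp add: P_norm_def)
qed

text \<open>The shift law is |\<open>upper x\<close>| = 1; strict positivity is
  \<open>poly_upper_not_AE_0\<close>.\<close>

sublocale toeplitz_form form
proof
  fix p q r :: "real poly" and c :: real
  show "form (p + q) r = form p r + form q r"
    by (simp only: form_def complex_poly_add poly_add distrib_right plus_complex.sel
        Bochner_Integration.integral_add integrable_form)
  show "form (smult c p) r = c * form p r"
    unfolding form_def by (subst integral_mult_right_zero[symmetric])
      (auto simp: complex_poly_smult algebra_simps intro!: Bochner_Integration.integral_cong)
  show "form p q = form q p"
    unfolding form_def by (intro Bochner_Integration.integral_cong) (auto simp: algebra_simps)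
  show "form (pCons 0 p) (pCons 0 q) = form p q"
  proof -
    have "upper x * u * cnj (upper x * v) = u * cnj v" for x u v
      using upper_mult_cnj[of x] by (metis complex_cnj_mult mult.assoc mult.commute mult.left_neutral)
    then show ?thesis
      by (simp only: form_def complex_poly_pCons poly_pCons of_real_0 add_0)
  qed
  assume "p \<noteq> 0"
  have form: "form p p = (\<integral>x. (norm (poly (complex_poly p) (upper x)))\<^sup>2 \<partial>M)"
    unfolding form_def by (simp only: complex_norm_square[symmetric] Re_complex_of_real)
  have "complex_poly p \<noteq> 0"
    using \<open>p \<noteq> 0\<close> by (simp add: map_poly_eq_0_iff)
  moreover have "integrable M (\<lambda>x. (norm (poly (complex_poly p) (upper x)))\<^sup>2)"
    using integrable_form[of p p] by (simp only: complex_norm_square[symmetric] Re_complex_of_real)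
  ultimately have "form p p \<noteq> 0"
    unfolding form using poly_upper_not_AE_0[of "complex_poly p"]
    by (subst integral_nonneg_eq_0_iff_AE) auto
  moreover have "form p p \<ge> 0"
    unfolding form by simp
  ultimately show "form p p > 0"
    by simp
qed

text \<open>The integrand is 2^n P_n(x) Re (z^(n-j)) = 2^n P_n(x) T_|n-j|(x), and 0 < j < 2n means
  |n-j| < n.\<close>

lemma form_geronimus_poly_monom:
  assumes "0 < j" and "j < 2 * n"
  shows "form (geronimus_poly b d n) (monom 1 j) = 0"
proof -
  obtain T :: "real poly" where T: "degree T \<le> nat \<bar>int n - int j\<bar>"
    "\<And>t. poly T (cos t) = cos (real (nat \<bar>int n - int j\<bar>) * t)"
    using cos_multiple_poly by blast
  \<comment> \<open>Evenness of the cosine absorbs the absolute value when \<open>j\<close> exceeds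
    \<open>n\<close>.\<close>
  have cos: "cos (real (nat \<bar>int n - int j\<bar>) * t) = cos ((real n - real j) * t)" for t
  proof (cases "j \<le> n")
    case False
    then have "cos (real (nat \<bar>int n - int j\<bar>) * t) = cos (- ((real n - real j) * t))"
      by (simp add: left_diff_distrib)
    then show ?thesis
      by (simp only: cos_minus)
  qed simp
  have "AE x in M. Re (poly (complex_poly (geronimus_poly b d n)) (upper x)
      * cnj (poly (complex_poly (monom 1 j)) (upper x))) = 2 ^ n * poly (P n * T) x"
    using AE_interval
  proof eventually_elim
    case (elim x)
    have "upper x ^ n * cnj (upper x ^ j) = cis ((real n - real j) * arccos x)"
      by (simp add: upper_def cis_cnj Complex.DeMoivre cis_mult algebra_simps)
    then have "Re (upper x ^ n * cnj (upper x ^ j)) = poly T (cos (arccos x))"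
      by (simp only: T(2) cos cis.sel)
    also have "\<dots> = poly T x"
      using elim by simp
    finally have T: "Re (upper x ^ n * cnj (upper x ^ j)) = poly T x" .
    have "poly (complex_poly (geronimus_poly b d n)) (upper x) * cnj (poly (complex_poly (monom 1 j)) (upper x))
        = (2 ^ n * poly (P n) x) *\<^sub>R (upper x ^ n * cnj (upper x ^ j))"
      by (simp add: complex_geronimus_poly Re_upper[OF elim] map_poly_monom poly_monom power_mult_distrib
          scaleR_conv_of_real)
    then show ?case
      by (simp only: scaleR_complex.sel T poly_mult mult.assoc)
  qed
  then have "form (geronimus_poly b d n) (monom 1 j) = (\<integral>x. 2 ^ n * poly (P n * T) x \<partial>M)"
    unfolding form_def
    by (intro integral_cong_AE borel_measurable_integrable integrable_form integrable_mult_right integrable_poly)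
  also have "\<dots> = 0"
    using P_orthogonal_less[of T n] T(1) assms by simp
  finally show ?thesis .
qed

lemma form_geronimus_poly: "form (geronimus_poly b d n) (geronimus_poly b d n) = 4 ^ n * P_norm n"
proof -
  have "AE x in M. Re (poly (complex_poly (geronimus_poly b d n)) (upper x)
      * cnj (poly (complex_poly (geronimus_poly b d n)) (upper x))) = 4 ^ n * poly (P n * P n) x"
    using AE_interval
  proof eventually_elim
    case (elim x)
    have "(norm (poly (complex_poly (geronimus_poly b d n)) (upper x)))\<^sup>2 = (2 ^ n * \<bar>poly (P n) x\<bar>)\<^sup>2"
      by (simp add: complex_geronimus_poly Re_upper[OF elim] norm_mult norm_power)
    also have "\<dots> = (2\<^sup>2) ^ n * (poly (P n) x)\<^sup>2"
      by (simp only: power_mult_distrib power2_abs power_mult[symmetric] mult.commute[of n])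
    finally show ?case
      unfolding complex_norm_square[symmetric] Re_complex_of_real by (simp add: power2_eq_square)
  qed
  then have "form (geronimus_poly b d n) (geronimus_poly b d n) = (\<integral>x. 4 ^ n * poly (P n * P n) x \<partial>M)"
    unfolding form_def
    by (intro integral_cong_AE borel_measurable_integrable integrable_form integrable_mult_right integrable_poly)
  then show ?thesis
    by (simp add: P_norm_def)
qed

lemma schur_relation_d:
  "4 * d (int n + 1) = (1 - schur (2 * n)) * (1 - (schur (2 * n + 1))\<^sup>2) * (1 + schur (2 * n + 2))"
  by (rule geronimus_relation_d[of b d])
     (simp_all add: form_geronimus_poly form_geronimus_poly_monom P_norm_Suc)

lemma schur_relation_b_0: "schur 1 = b 1"
  using geronimus_relation_b_0 form_geronimus_poly_monom by blast

lemma schur_relation_b: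
  "2 * b (int n + 2) = (1 - schur (2 * n + 2)) * schur (2 * n + 3)
    - (1 + schur (2 * n + 2)) * schur (2 * n + 1)"
  using geronimus_relation_b form_geronimus_poly_monom by blast

section \<open>Identification of the Verblunsky coefficients\<close>

lemma monic_orthogonal_circle_less:
  assumes "monic_orthogonal_circle (szego_measure M) \<Phi>" and "degree p < n"
  shows "(\<integral>z. poly (\<Phi> n) z * cnj (poly p z) \<partial>szego_measure M) = 0"
proof -
  have monic: "\<And>n. degree (\<Phi> n) = n \<and> lead_coeff (\<Phi> n) = 1"
    and orth: "\<And>m n. m \<noteq> n \<Longrightarrow> (\<integral>z. poly (\<Phi> m) z * cnj (poly (\<Phi> n) z) \<partial>szego_measure M) = 0"
    using assms(1) unfolding monic_orthogonal_circle_def by blast+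
  have int: "integrable (szego_measure M) (\<lambda>z. poly (\<Phi> n) z * cnj (poly p z))" for p
    by (intro integrable_szego_measure continuous_intros)
  from monic assms(2) show ?thesis
  proof (rule monic_sequence_span_induct[of \<Phi> p n], goal_cases)
    case (2 p q)
    then show ?case
      using int[of p] int[of q] by (simp add: distrib_left)
  next
    case (3 c p)
    have "(\<integral>z. poly (\<Phi> n) z * cnj (poly (smult c p) z) \<partial>szego_measure M)
        = (\<integral>z. cnj c * (poly (\<Phi> n) z * cnj (poly p z)) \<partial>szego_measure M)"
      by (simp add: mult.left_commute)
    also have "\<dots> = 0"
      by (simp only: integral_mult_right_zero 3 mult_zero_right)
    finally show ?case .
  next
    case (4 m)
    then show ?case by (simp add: orth)
  qed simp
qed

text \<open>Resolves the definite description in \<open>monic_opuc\<close>. The difference D of two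
  candidates has lower degree, hence is orthogonal to both and to itself, so it vanishes almost
  everywhere on the circle and must be zero.\<close>

lemma monic_orthogonal_circle_unique:
  assumes "monic_orthogonal_circle (szego_measure M) \<Phi>" "monic_orthogonal_circle (szego_measure M) \<Psi>"
  shows "\<Phi> = \<Psi>"
proof
  fix n
  define D where "D = \<Phi> n - \<Psi> n"
  have monic: "degree (\<Phi> n) = n" "coeff (\<Phi> n) n = 1" "degree (\<Psi> n) = n" "coeff (\<Psi> n) n = 1"
    using assms unfolding monic_orthogonal_circle_def by metis+
  have "degree D \<le> n" "coeff D n = 0"
    unfolding D_def using monic by (auto intro!: degree_diff_le)
  then consider "D = 0" | "degree D < n"
    using degree_less_or_zero by blast
  then show "\<Phi> n = \<Psi> n"
  proof cases
    case 2
    have "(\<integral>z. poly D z * cnj (poly D z) \<partial>szego_measure M)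
        = (\<integral>z. poly (\<Phi> n) z * cnj (poly D z) - poly (\<Psi> n) z * cnj (poly D z) \<partial>szego_measure M)"
      by (intro Bochner_Integration.integral_cong refl) (simp add: D_def left_diff_distrib)
    also have "\<dots> = 0"
      using monic_orthogonal_circle_less[OF assms(1) 2] monic_orthogonal_circle_less[OF assms(2) 2]
      by (subst Bochner_Integration.integral_diff) (auto intro!: integrable_szego_measure continuous_intros)
    finally have "(\<integral>z. complex_of_real ((norm (poly D z))\<^sup>2) \<partial>szego_measure M) = 0"
      by (simp only: complex_norm_square[symmetric])
    then have "(\<integral>z. (norm (poly D z))\<^sup>2 \<partial>szego_measure M) = 0"
      by (simp only: integral_complex_of_real of_real_eq_0_iff)
    then have "(\<integral>x. (1/2) *\<^sub>R ((norm (poly D (upper x)))\<^sup>2 + (norm (poly D (cnj (upper x))))\<^sup>2) \<partial>M) = 0"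
      by (subst (asm) integral_szego_measure) (auto intro!: continuous_intros)
    moreover have "integrable M (\<lambda>x. (1/2) *\<^sub>R ((norm (poly D (upper x)))\<^sup>2 + (norm (poly D (cnj (upper x))))\<^sup>2))"
      by (intro integrable_upper[of "\<lambda>z. (1/2) *\<^sub>R ((norm (poly D z))\<^sup>2 + (norm (poly D (cnj z)))\<^sup>2)"]
          continuous_intros)
    ultimately have "AE x in M. (1/2) *\<^sub>R ((norm (poly D (upper x)))\<^sup>2 + (norm (poly D (cnj (upper x))))\<^sup>2) = 0"
      by (subst (asm) integral_nonneg_eq_0_iff_AE) auto
    then have "AE x in M. poly D (upper x) = 0"
      by eventually_elim (simp add: sum_power2_eq_zero_iff)
    then show ?thesis
      using poly_upper_not_AE_0[of D] by (auto simp: D_def)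
  qed (simp add: D_def)
qed

lemma monic_orthogonal_circle_opuc:
  "monic_orthogonal_circle (szego_measure M) (\<lambda>n. complex_poly (opuc n))"
  unfolding monic_orthogonal_circle_def form_eq_integral_szego
proof (intro conjI allI impI)
  fix m n :: nat
  assume "m \<noteq> n"
  then show "complex_of_real (form (opuc m) (opuc n)) = 0"
    using opuc_orthogonal[of "opuc n" m] opuc_orthogonal[of "opuc m" n] commute[of "opuc m" "opuc n"]
    by (cases "n < m") auto
qed (simp_all add: coeff_map_poly)

text \<open>The conjugation disappears because the coefficients are real; at -1 both sides are -1 by
  convention.\<close>

lemma verblunsky_szego_measure:
  assumes "i \<ge> -1"
  shows "verblunsky (szego_measure M) i = of_real (schur (nat (i + 1)))"
proof (cases "i = -1")
  case False
  have "monic_opuc (szego_measure M) = (\<lambda>n. complex_poly (opuc n))"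
    unfolding monic_opuc_def using monic_orthogonal_circle_opuc monic_orthogonal_circle_unique
    by blast
  then show ?thesis
    using False assms by (simp add: verblunsky_def poly_0_coeff_0 coeff_map_poly schur_def)
qed (simp add: verblunsky_def)

end

section \<open>The relations solved for the Verblunsky coefficients, and the shift by k\<close>

theorem geronimus_relations:
  fixes M :: "real measure" and b d :: "int \<Rightarrow> real"
  assumes "prob_space M" and "sets M = sets borel" and "AE x in M. x \<in> {-1..1}"
    and "recurrence_coeffs M b d"
  defines "\<alpha> \<equiv> verblunsky (szego_measure M)"
  shows "\<alpha> 0 = of_real (b 1)"
    and "\<alpha> 1 = - 1 + 2 * of_real (d 1) / (1 - (\<alpha> 0)\<^sup>2)"
    and "m \<ge> 1 \<Longrightarrow> \<alpha> (2 * m) = (2 * of_real (b (m + 1)) + (1 + \<alpha> (2 * m - 1)) * \<alpha> (2 * m - 2))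
      / (1 - \<alpha> (2 * m - 1))"
    and "m \<ge> 1 \<Longrightarrow> \<alpha> (2 * m + 1) = - 1 + 4 * of_real (d (m + 1))
      / ((1 - \<alpha> (2 * m - 1)) * (1 - (\<alpha> (2 * m))\<^sup>2))"
proof -
  interpret prob_space M by fact
  interpret jacobi_measure M b d
    using assms by unfold_locales auto
  have \<alpha>: "\<alpha> i = of_real (schur (nat (i + 1)))" if "i \<ge> -1" for i
    unfolding \<alpha>_def using that by (rule verblunsky_szego_measure)
  have solve_d: "schur (2 * n + 2)
      = - 1 + 4 * d (int n + 1) / ((1 - schur (2 * n)) * (1 - (schur (2 * n + 1))\<^sup>2))" for n
    using schur_relation_d[of n] schur_less_1[of "2 * n"] schur_square_less_1[of "2 * n + 1"]
    by simp
  show "\<alpha> 0 = of_real (b 1)"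
    using schur_relation_b_0 by (simp add: \<alpha>)
  define X where "X = 1 - (schur 1)\<^sup>2"
  \<comment> \<open>The 2 in the denominator is 1 - \<open>schur 0\<close>; it explains the constant
    2 instead of 4 in the formula for the coefficient at 1.\<close>
  have "schur 2 = - 1 + 4 * d 1 / (2 * X)"
    using solve_d[of 0] by (simp add: X_def numeral_2_eq_2)
  then have "schur 2 = - 1 + 2 * d 1 / X"
    by simp
  moreover have "\<alpha> 0 = of_real (schur 1)" "\<alpha> 1 = of_real (schur 2)"
    by (simp_all add: \<alpha>)
  ultimately show "\<alpha> 1 = - 1 + 2 * of_real (d 1) / (1 - (\<alpha> 0)\<^sup>2)"
    by (simp add: X_def)
  assume "m \<ge> 1"
  then obtain n where m: "m = int n + 1"
    by (metis zle_iff_zadd add.commute)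
  have i: "nat (2 * m - 2 + 1) = 2 * n + 1" "nat (2 * m - 1 + 1) = 2 * n + 2"
    "nat (2 * m + 1) = 2 * n + 3" "nat (2 * m + 1 + 1) = 2 * n + 4"
    unfolding m by simp_all
  have \<alpha>m: "\<alpha> (2 * m - 2) = of_real (schur (2 * n + 1))" "\<alpha> (2 * m - 1) = of_real (schur (2 * n + 2))"
    "\<alpha> (2 * m) = of_real (schur (2 * n + 3))" "\<alpha> (2 * m + 1) = of_real (schur (2 * n + 4))"
    using \<open>m \<ge> 1\<close> by (simp_all only: \<alpha> i)
  have "schur (2 * n + 3) = (2 * b (m + 1) + (1 + schur (2 * n + 2)) * schur (2 * n + 1))
      / (1 - schur (2 * n + 2))"
    using schur_relation_b[of n] schur_less_1[of "2 * n + 2"] by (simp add: m field_simps)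
  then show "\<alpha> (2 * m) = (2 * of_real (b (m + 1)) + (1 + \<alpha> (2 * m - 1)) * \<alpha> (2 * m - 2))
      / (1 - \<alpha> (2 * m - 1))"
    unfolding \<alpha>m by (simp only: of_real_add of_real_mult of_real_diff of_real_divide of_real_1 of_real_numeral)
  have "schur (2 * n + 4) = - 1 + 4 * d (m + 1) / ((1 - schur (2 * n + 2)) * (1 - (schur (2 * n + 3))\<^sup>2))"
    using solve_d[of "n + 1"] by (simp add: m numeral_3_eq_3 eval_nat_numeral)
  then show "\<alpha> (2 * m + 1) = - 1 + 4 * of_real (d (m + 1))
      / ((1 - \<alpha> (2 * m - 1)) * (1 - (\<alpha> (2 * m))\<^sup>2))"
    unfolding \<alpha>m by (simp only: of_real_add of_real_mult of_real_diff of_real_divide of_real_1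
        of_real_numeral of_real_minus of_real_power)
qed

theorem theorem3:
  fixes \<mu> \<nu> :: "real measure" and b d :: "int \<Rightarrow> real" and k :: nat
  assumes "prob_space \<mu>" and "sets \<mu> = sets borel"
    and "nontrivial_measure \<mu>" and "msupport \<mu> \<subseteq> {-1..1}"
    and "recurrence_coeffs \<mu> b d"
    and "k \<ge> 1"
    and "\<forall>i\<in>{1 - int k..0}. d i > 0"
    and "prob_space \<nu>" and "sets \<nu> = sets borel"
    and "monic_orthogonal_line \<nu> (anti_associated k b d)"
    and "msupport \<nu> \<subseteq> {-1..1}"
  shows "let \<alpha> = verblunsky (szego_measure \<nu>) in
    \<alpha> 0 = of_real (b (1 - int k)) \<and>
    \<alpha> 1 = - 1 + 2 * of_real (d (1 - int k)) / (1 - (\<alpha> 0)\<^sup>2) \<and>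
    (\<forall>m::int\<ge>1. \<alpha> (2 * m) =
       (2 * of_real (b (m - int k + 1)) + (1 + \<alpha> (2 * m - 1)) * \<alpha> (2 * m - 2))
         / (1 - \<alpha> (2 * m - 1))) \<and>
    (\<forall>m::int\<ge>1. \<alpha> (2 * m + 1) =
       - 1 + 4 * of_real (d (m - int k + 1))
         / ((1 - \<alpha> (2 * m - 1)) * (1 - (\<alpha> (2 * m))\<^sup>2)))"
proof -
  \<comment> \<open>For \<open>n\<close> up to \<open>k\<close> the index falls among the new
    coefficients, beyond that among the original ones.\<close>
  have "d (n - int k) > 0" if "n \<ge> 1" for n
    using assms(5,7) that by (cases "n \<le> int k") (auto simp: recurrence_coeffs_def)
  then have "recurrence_coeffs \<nu> (\<lambda>n. b (n - int k)) (\<lambda>n. d (n - int k))"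
    using assms(10) by (simp add: recurrence_coeffs_def anti_associated_def)
  moreover have "AE x in \<nu>. x \<in> {-1..1}"
    using assms(9,11) by (intro AE_in_closed_superset_msupport) auto
  ultimately show ?thesis
    using geronimus_relations[of \<nu> "\<lambda>n. b (n - int k)" "\<lambda>n. d (n - int k)"] assms(8,9)
    by (simp add: Let_def algebra_simps)
qed

end
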